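(* Let $G$ be a countable group, $S \subset G$ a finite nonempty set, $\mathcal{C}$ an $S$-UCP convexoid on $G$, $A$ a finite nonempty alphabet, $k \geq 1$, let $\mathcal{T} \subset A^S$ have $k$-TEP (with respect to $\mathcal{C}$), and let $X = \{x \in A^G : \forall g \in G,\ (gx)|_S \in \mathcal{T}\}$ be the SFT with allowed patterns $\mathcal{T}$. If $C \in \mathcal{C}$ and $P \in A^C$ is $\mathcal{T}$-legal, then there is $x \in X$ with $x|_C = P$. Moreover, if $G$ has decidable word problem and $\mathcal{C}$ is recursively enumerable, then the language of $X$ (the set of finite patterns that occur in $X$) is computable, uniformly in the description of $\mathcal{T}$; i.e. there is an algorithm which, given such a family $\mathcal{T} \subset A^S$ and a finite pattern $P$ over $A$ with domain a finite subset of $G$, decides whether $P$ occurs in $X$.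
   Context: Action: $(gx)_h = x_{g^{-1}h}$ for $x \in A^G$; for $P \in A^C$, $gP \in A^{gC}$ is given by $(gP)_h = P_{g^{-1}h}$. A pattern $P \in A^C$ ($C \subset G$) is $\mathcal{T}$-legal if for all $g \in G$ with $gS \subset C$ we have $(g^{-1}P)|_S \in \mathcal{T}$. A pattern $P\in A^C$ occurs in $X$ if $P = x|_C$ for some $x \in X$. Convexoid: a family $\mathcal{C}$ of finite subsets of $G$ such that $\emptyset \in \mathcal{C}$, every finite subset of $G$ is contained in some element of $\mathcal{C}$, and whenever $C, D \in \mathcal{C}$ with $C \subsetneq D$ there is $a \in D \setminus C$ with $C \cup \{a\} \in \mathcal{C}$. For finite $B \subset G$ put $\overline{B} = \bigcap\{C \in \mathcal{C} : B \subset C\}$; the lax corners of $B$ are $\angle B = \{a \in B : a \notin \overline{B \setminus \{a\}}\}$. The convexoid is $S$-UCP if for all $C \in \mathcal{C}$ and $a \in \angle C$ there is at most one $g \in G$ with $a \in gS \subset C$. $k$-TEP: for $\emptyset \neq E \subset S$, $\mathcal{T} \subset A^S$ has $k$-uniform $E$-extensions if for every $s \in E$ and every $P \in A^{S \setminus \{s\}}$ there are exactly $k$ symbols $a \in A$ such that the extension of $P$ to $S$ with value $a$ at $s$ lies in $\mathcal{T}$. $\mathcal{T}$ has $k$-TEP if for every $g \in G$ it has $k$-uniform $(g^{-1}\angle(gS))$-extensions. Computability: an encoded group is a group together with a bijection with a subset of the words over a finite alphabet; "$G$ has decidable word problem" means that $G$ is considered with an encoding for which the set of codes is decidable and product and inversion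 are computable. Finite subsets of $G$ and finite patterns are encoded as words in the standard way, so recursive enumerability of $\mathcal{C}$ and decidability of the language make sense. *)

theory Defs
  imports
    "HOL-Algebra.Coset"
    "HOL-Library.Nat_Bijection"
    "HOL-Library.Countable_Set"
    "HOL-Library.FuncSet"
begin

text \<open>
  A pattern in \<open>A\<^sup>C\<close> is an element of the extensional function space
  \<^term>\<open>C \<rightarrow>\<^sub>E A\<close>; a configuration is the case where \<open>C\<close> is the carrier of the group.
\<close>

definition shift :: "('g, 'm) monoid_scheme \<Rightarrow> 'g \<Rightarrow> 'g set \<Rightarrow> ('g \<Rightarrow> 'a) \<Rightarrow> ('g \<Rightarrow> 'a)" where
  "shift G g C P = restrict (\<lambda>h. P (inv\<^bsub>G\<^esub> g \<otimes>\<^bsub>G\<^esub> h)) (g <#\<^bsub>G\<^esub> C)"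

definition legal_pattern ::
  "('g, 'm) monoid_scheme \<Rightarrow> 'g set \<Rightarrow> ('g \<Rightarrow> 'a) set \<Rightarrow> 'g set \<Rightarrow> ('g \<Rightarrow> 'a) \<Rightarrow> bool" where
  "legal_pattern G S T C P \<longleftrightarrow>
     (\<forall>g\<in>carrier G. g <#\<^bsub>G\<^esub> S \<subseteq> C \<longrightarrow> restrict (shift G (inv\<^bsub>G\<^esub> g) C P) S \<in> T)"

definition SFT ::
  "('g, 'm) monoid_scheme \<Rightarrow> 'g set \<Rightarrow> 'a set \<Rightarrow> ('g \<Rightarrow> 'a) set \<Rightarrow> ('g \<Rightarrow> 'a) set" where
  "SFT G S A T =
     {x \<in> carrier G \<rightarrow>\<^sub>E A. \<forall>g\<in>carrier G. restrict (shift G g (carrier G) x) S \<in> T}"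

definition occurs_in :: "'g set \<Rightarrow> ('g \<Rightarrow> 'a) \<Rightarrow> ('g \<Rightarrow> 'a) set \<Rightarrow> bool" where
  "occurs_in C P X \<longleftrightarrow> (\<exists>x\<in>X. P = restrict x C)"

definition convexoid :: "('g, 'm) monoid_scheme \<Rightarrow> 'g set set \<Rightarrow> bool" where
  "convexoid G \<C> \<longleftrightarrow>
     (\<forall>C\<in>\<C>. finite C \<and> C \<subseteq> carrier G) \<and>
     {} \<in> \<C> \<and>
     (\<forall>F. finite F \<and> F \<subseteq> carrier G \<longrightarrow> (\<exists>C\<in>\<C>. F \<subseteq> C)) \<and>
     (\<forall>C\<in>\<C>. \<forall>D\<in>\<C>. C \<subset> D \<longrightarrow> (\<exists>a\<in>D - C. C \<union> {a} \<in> \<C>))"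

definition convex_closure :: "'g set set \<Rightarrow> 'g set \<Rightarrow> 'g set" where
  "convex_closure \<C> B = \<Inter>{C \<in> \<C>. B \<subseteq> C}"

definition lax_corners :: "'g set set \<Rightarrow> 'g set \<Rightarrow> 'g set" where
  "lax_corners \<C> B = {a \<in> B. a \<notin> convex_closure \<C> (B - {a})}"

definition UCP :: "('g, 'm) monoid_scheme \<Rightarrow> 'g set \<Rightarrow> 'g set set \<Rightarrow> bool" where
  "UCP G S \<C> \<longleftrightarrow>
     (\<forall>C\<in>\<C>. \<forall>a\<in>lax_corners \<C> C.
        \<exists>\<^sub>\<le>\<^sub>1 g. g \<in> carrier G \<and> a \<in> g <#\<^bsub>G\<^esub> S \<and> g <#\<^bsub>G\<^esub> S \<subseteq> C)"

definition uniform_extensions ::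
  "nat \<Rightarrow> 'g set \<Rightarrow> 'g set \<Rightarrow> 'a set \<Rightarrow> ('g \<Rightarrow> 'a) set \<Rightarrow> bool" where
  "uniform_extensions k E S A T \<longleftrightarrow>
     (\<forall>s\<in>E. \<forall>P \<in> (S - {s}) \<rightarrow>\<^sub>E A. card {a \<in> A. P(s := a) \<in> T} = k)"

definition TEP ::
  "('g, 'm) monoid_scheme \<Rightarrow> 'g set set \<Rightarrow> 'g set \<Rightarrow> 'a set \<Rightarrow> nat \<Rightarrow> ('g \<Rightarrow> 'a) set \<Rightarrow> bool" where
  "TEP G \<C> S A k T \<longleftrightarrow>
     (\<forall>g\<in>carrier G.
        uniform_extensions k (inv\<^bsub>G\<^esub> g <#\<^bsub>G\<^esub> lax_corners \<C> (g <#\<^bsub>G\<^esub> S)) S A T)"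

text \<open>
  The partial recursive functions, presented with unary functions and the pairing function
  \<^const>\<open>prod_encode\<close> in place of functions of several arguments.  The last two rules are
  primitive recursion (the input encodes a parameter \<open>a\<close> and a recursion argument) and
  unbounded minimisation (all values below the minimum must be defined and positive).
\<close>

inductive partial_recursive :: "(nat \<rightharpoonup> nat) \<Rightarrow> bool" where
  zero: "partial_recursive (\<lambda>n. Some 0)"
| succ: "partial_recursive (\<lambda>n. Some (Suc n))"
| left: "partial_recursive (\<lambda>n. Some (fst (prod_decode n)))"
| right: "partial_recursive (\<lambda>n. Some (snd (prod_decode n)))"
| pair: "partial_recursive f \<Longrightarrow> partial_recursive g \<Longrightarrow>
    partial_recursive (\<lambda>n. Option.bind (f n) (\<lambda>x. Option.bind (g n) (\<lambda>y.
      Some (prod_encode (x, y)))))"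
| comp: "partial_recursive f \<Longrightarrow> partial_recursive g \<Longrightarrow>
    partial_recursive (\<lambda>n. Option.bind (g n) f)"
| prec: "partial_recursive f \<Longrightarrow> partial_recursive g \<Longrightarrow>
    partial_recursive (\<lambda>n. case prod_decode n of (a, m) \<Rightarrow>
      rec_nat (f a)
        (\<lambda>i r. Option.bind r (\<lambda>v. g (prod_encode (a, prod_encode (i, v))))) m)"
| minim: "partial_recursive f \<Longrightarrow>
    partial_recursive (\<lambda>a.
      if \<exists>m. f (prod_encode (a, m)) = Some 0 \<and>
             (\<forall>i<m. \<exists>v. f (prod_encode (a, i)) = Some (Suc v))
      then Some (LEAST m. f (prod_encode (a, m)) = Some 0)
      else None)"

definition decidable_set :: "nat set \<Rightarrow> bool" where
  "decidable_set N \<longleftrightarrow>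
     (\<exists>f. partial_recursive f \<and> (\<forall>n. f n = Some (if n \<in> N then 1 else 0)))"

definition recursively_enumerable_set :: "nat set \<Rightarrow> bool" where
  "recursively_enumerable_set N \<longleftrightarrow>
     N = {} \<or> (\<exists>e. partial_recursive (\<lambda>n. Some (e n)) \<and> N = range e)"

text \<open>
  Words over the finite alphabet \<^term>\<open>{..<m::nat}\<close> are lists of natural numbers, and are passed
  to partial recursive functions through \<^const>\<open>list_encode\<close>.
\<close>

definition encoded_group ::
  "('g, 'm) monoid_scheme \<Rightarrow> nat \<Rightarrow> ('g \<Rightarrow> nat list) \<Rightarrow> bool" where
  "encoded_group G m code \<longleftrightarrow>
     group G \<and> inj_on code (carrier G) \<and> code ` carrier G \<subseteq> lists {..<m}"

definition elt_code :: "('g \<Rightarrow> nat list) \<Rightarrow> 'g \<Rightarrow> nat" where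
  "elt_code code g = list_encode (code g)"

definition decidable_word_problem ::
  "('g, 'm) monoid_scheme \<Rightarrow> nat \<Rightarrow> ('g \<Rightarrow> nat list) \<Rightarrow> bool" where
  "decidable_word_problem G m code \<longleftrightarrow>
     encoded_group G m code \<and>
     decidable_set (elt_code code ` carrier G) \<and>
     (\<exists>f. partial_recursive f \<and>
        (\<forall>g\<in>carrier G. \<forall>h\<in>carrier G.
           f (prod_encode (elt_code code g, elt_code code h)) = Some (elt_code code (g \<otimes>\<^bsub>G\<^esub> h)))) \<and>
     (\<exists>f. partial_recursive f \<and>
        (\<forall>g\<in>carrier G. f (elt_code code g) = Some (elt_code code (inv\<^bsub>G\<^esub> g))))"

text \<open>
  A finite set of objects has as its code the canonical index \<^const>\<open>set_encode\<close> of the set of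
  their codes, i.e. the sum of the powers of 2 with these exponents.  A pattern is coded as its graph, with
  symbols numbered by \<open>\<alpha>\<close>.  These codes are only meaningful for finite sets.
\<close>

definition finset_code :: "('g \<Rightarrow> nat list) \<Rightarrow> 'g set \<Rightarrow> nat" where
  "finset_code code C = set_encode (elt_code code ` C)"

definition pattern_code ::
  "('g \<Rightarrow> nat list) \<Rightarrow> ('a \<Rightarrow> nat) \<Rightarrow> 'g set \<Rightarrow> ('g \<Rightarrow> 'a) \<Rightarrow> nat" where
  "pattern_code code \<alpha> C P = set_encode ((\<lambda>g. prod_encode (elt_code code g, \<alpha> (P g))) ` C)"

definition family_code ::
  "('g \<Rightarrow> nat list) \<Rightarrow> ('a \<Rightarrow> nat) \<Rightarrow> 'g set \<Rightarrow> ('g \<Rightarrow> 'a) set \<Rightarrow> nat" where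
  "family_code code \<alpha> S T = set_encode (pattern_code code \<alpha> S ` T)"

end

theory Submission
  imports Defs
begin

text \<open>
  Two sets of a convexoid, one inside the other, are joined by a chain that adds one cell at a
  time. When a cell is added to a convex set, it is a lax corner of the larger set, so by UCP at
  most one translate of the shape is completed; TEP makes the number of admissible symbols in that
  translate equal to \<open>k\<close>, hence nonzero. Thus legal patterns extend from convex sets to
  larger convex sets (\<open>legal_pattern_extend\<close>), and along an exhausting chain of convex sets to
  the whole group (\<open>legal_pattern_extend_SFT\<close>).

  Consequently a pattern on an arbitrary finite set occurs in the subshift if and only if it is
  the restriction of a legal pattern on some convex superset \<open>D\<close>, and any such \<open>D\<close> will do
  (\<open>occurs_in_SFT_iff\<close>). This is an algorithm: enumerate the convexoid until a suitable
  \<open>D\<close> appears, and go through the finitely many patterns on \<open>D\<close>.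

  To carry it out with codes of natural numbers, the test of a candidate code on \<open>D\<close> is written
  with membership in coded finite sets, bounded quantifiers and right multiplications by fixed
  group elements only (\<open>codes_legal_extension\<close>), so that its computability follows from closure
  rules for decidable predicates. The allowed patterns enter the test through their code, which
  gives uniformity.
\<close>

section \<open>Extending legal patterns\<close>

lemma convexoid_finite: "convexoid G \<C> \<Longrightarrow> C \<in> \<C> \<Longrightarrow> finite C"
  by (simp add: convexoid_def)

lemma convexoid_subset: "convexoid G \<C> \<Longrightarrow> C \<in> \<C> \<Longrightarrow> C \<subseteq> carrier G"
  by (simp add: convexoid_def)

lemma convexoid_cofinal:
  "convexoid G \<C> \<Longrightarrow> finite F \<Longrightarrow> F \<subseteq> carrier G \<Longrightarrow> \<exists>C\<in>\<C>. F \<subseteq> C"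
  by (simp add: convexoid_def)

context group
begin

lemma l_coset_subset_iff: "g <# S \<subseteq> C \<longleftrightarrow> (\<forall>s\<in>S. g \<otimes> s \<in> C)"
  by (auto simp: l_coset_def)

lemma shift_inv_restrict:
  assumes "g \<in> carrier G" "S \<subseteq> carrier G" "C \<subseteq> carrier G" "\<forall>s\<in>S. g \<otimes> s \<in> C"
  shows "restrict (shift G (inv g) C P) S = (\<lambda>s\<in>S. P (g \<otimes> s))"
proof (rule restrict_ext)
  fix s assume s: "s \<in> S"
  have "s = inv g \<otimes> (g \<otimes> s)"
    using s assms by (simp add: m_assoc[symmetric] subset_iff)
  then have "s \<in> inv g <# C"
    using s assms by (auto simp: l_coset_def)
  then show "shift G (inv g) C P s = P (g \<otimes> s)"
    using s assms by (simp add: shift_def)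
qed

lemma legal_pattern_iff:
  assumes "S \<subseteq> carrier G" "C \<subseteq> carrier G"
  shows "legal_pattern G S T C P \<longleftrightarrow>
    (\<forall>g\<in>carrier G. (\<forall>s\<in>S. g \<otimes> s \<in> C) \<longrightarrow> (\<lambda>s\<in>S. P (g \<otimes> s)) \<in> T)"
  using assms by (auto simp: legal_pattern_def l_coset_subset_iff shift_inv_restrict)

lemma SFT_iff_legal:
  assumes "S \<subseteq> carrier G"
  shows "x \<in> SFT G S A T \<longleftrightarrow> x \<in> carrier G \<rightarrow>\<^sub>E A \<and> legal_pattern G S T (carrier G) x"
proof -
  have "(\<forall>g\<in>carrier G. restrict (shift G g (carrier G) x) S \<in> T) \<longleftrightarrow>
    (\<forall>g\<in>carrier G. restrict (shift G (inv g) (carrier G) x) S \<in> T)"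
    by (metis inv_closed inv_inv)
  moreover have "\<forall>g\<in>carrier G. g <# S \<subseteq> carrier G"
    using assms l_coset_subset_G by blast
  ultimately show ?thesis
    by (simp add: SFT_def legal_pattern_def)
qed

lemma legal_pattern_restrict:
  assumes "S \<subseteq> carrier G" "C \<subseteq> D" "D \<subseteq> carrier G" "legal_pattern G S T D P"
  shows "legal_pattern G S T C (restrict P C)"
proof -
  have "(\<lambda>s\<in>S. restrict P C (g \<otimes> s)) \<in> T"
    if g: "g \<in> carrier G" "\<forall>s\<in>S. g \<otimes> s \<in> C" for g
  proof -
    have "(\<lambda>s\<in>S. restrict P C (g \<otimes> s)) = (\<lambda>s\<in>S. P (g \<otimes> s))"
      using g by (auto intro: restrict_ext)
    moreover have "\<forall>s\<in>S. g \<otimes> s \<in> D"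
      using g(2) assms(2) by blast
    ultimately show ?thesis
      using g(1) assms(4) by (simp add: legal_pattern_iff[OF assms(1,3)])
  qed
  then show ?thesis
    using assms by (subst legal_pattern_iff) auto
qed

text \<open>
  Enlarging a convex set by one cell creates at most one new translate of the shape, and the new
  cell is a corner of that translate: all other cells of the translate lie in the convex set that
  is already filled, so their closure cannot contain the new one. Uniform extension at that
  corner supplies a symbol.
\<close>

lemma legal_pattern_extend_cell:
  assumes S: "S \<subseteq> carrier G"
    and conv: "convexoid G \<C>" and ucp: "UCP G S \<C>" and tep: "TEP G \<C> S A k T"
    and A: "A \<noteq> {}" and k: "k \<ge> 1"
    and C: "C \<in> \<C>" and aC: "insert a C \<in> \<C>" and a: "a \<notin> C"
    and P: "P \<in> C \<rightarrow>\<^sub>E A" and legal: "legal_pattern G S T C P"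
  shows "\<exists>b\<in>A. legal_pattern G S T (insert a C) (P(a := b))"
proof -
  have CG: "C \<subseteq> carrier G" and aCG: "insert a C \<subseteq> carrier G"
    using convexoid_subset[OF conv] C aC by blast+
  have old: "(\<lambda>s\<in>S. (P(a := b)) (g \<otimes> s)) \<in> T"
    if g: "g \<in> carrier G" "\<forall>s\<in>S. g \<otimes> s \<in> insert a C" "a \<notin> g <# S" for g b
  proof -
    have ne: "g \<otimes> s \<noteq> a" if "s \<in> S" for s
      using g(3) that by (auto simp: l_coset_def)
    then have "(\<lambda>s\<in>S. (P(a := b)) (g \<otimes> s)) = (\<lambda>s\<in>S. P (g \<otimes> s))"
      by (auto intro: restrict_ext)
    moreover have "\<forall>s\<in>S. g \<otimes> s \<in> C"
      using g(2) ne by blast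
    ultimately show ?thesis
      using legal g(1) legal_pattern_iff[OF S CG] by auto
  qed
  show ?thesis
  proof (cases "\<exists>g. g \<in> carrier G \<and> a \<in> g <# S \<and> g <# S \<subseteq> insert a C")
    case False
    then have "legal_pattern G S T (insert a C) (P(a := b))" for b
      using old by (subst legal_pattern_iff[OF S aCG]) (auto simp: l_coset_subset_iff)
    then show ?thesis
      using A by blast
  next
    case True
    then obtain g where g: "g \<in> carrier G" "a \<in> g <# S" "g <# S \<subseteq> insert a C"
      by blast
    have "a \<notin> convex_closure \<C> (insert a C - {a})"
      using a C by (auto simp: convex_closure_def)
    then have "a \<in> lax_corners \<C> (insert a C)"
      by (simp add: lax_corners_def)
    then have uniq: "g' = g"
      if "g' \<in> carrier G" "a \<in> g' <# S" "g' <# S \<subseteq> insert a C" for g'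
    proof -
      have "\<exists>\<^sub>\<le>\<^sub>1 g. g \<in> carrier G \<and> a \<in> g <# S \<and> g <# S \<subseteq> insert a C"
        using ucp aC \<open>a \<in> lax_corners \<C> (insert a C)\<close> by (simp add: UCP_def)
      then show ?thesis
        using g that unfolding Uniq_def by blast
    qed
    have "(g <# S) - {a} \<subseteq> C"
      using g(3) by blast
    then have "a \<notin> convex_closure \<C> ((g <# S) - {a})"
      using a C by (auto simp: convex_closure_def)
    then have corner: "a \<in> lax_corners \<C> (g <# S)"
      using g(2) by (simp add: lax_corners_def)
    obtain s where s: "s \<in> S" "a = g \<otimes> s"
      using g(2) by (auto simp: l_coset_def)
    have "s = inv g \<otimes> a"
      using s g(1) S by (simp add: m_assoc[symmetric] subset_iff)
    then have "s \<in> inv g <# lax_corners \<C> (g <# S)"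
      using corner by (auto simp: l_coset_def)
    then have ext: "card {b \<in> A. Q(s := b) \<in> T} = k" if "Q \<in> S - {s} \<rightarrow>\<^sub>E A" for Q
      using tep g(1) that unfolding TEP_def uniform_extensions_def by blast
    define Q where "Q = (\<lambda>s'\<in>S - {s}. P (g \<otimes> s'))"
    have ne: "g \<otimes> s' \<noteq> a" if "s' \<in> S" "s' \<noteq> s" for s'
      using that s g(1) S by (auto simp: subset_iff)
    have "g \<otimes> s' \<in> C" if "s' \<in> S" "s' \<noteq> s" for s'
      using that ne g(3) by (auto simp: l_coset_subset_iff)
    then have "Q \<in> S - {s} \<rightarrow>\<^sub>E A"
      using P by (auto simp: Q_def)
    from ext[OF this] k have "{b \<in> A. Q(s := b) \<in> T} \<noteq> {}"
      by (metis One_nat_def card.empty not_one_le_zero)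
    then obtain b where b: "b \<in> A" "Q(s := b) \<in> T"
      by blast
    have "(\<lambda>s\<in>S. (P(a := b)) (g \<otimes> s)) = Q(s := b)"
      using s ne by (auto simp: Q_def fun_eq_iff)
    then have new: "(\<lambda>s\<in>S. (P(a := b)) (g \<otimes> s)) \<in> T"
      using b(2) by simp
    have "(\<lambda>s\<in>S. (P(a := b)) (g' \<otimes> s)) \<in> T"
      if g': "g' \<in> carrier G" "\<forall>s\<in>S. g' \<otimes> s \<in> insert a C" for g'
    proof (cases "a \<in> g' <# S")
      case True
      then have "g' = g"
        using uniq g' by (simp add: l_coset_subset_iff)
      then show ?thesis
        using new by simp
    qed (use old g' in blast)
    then have "legal_pattern G S T (insert a C) (P(a := b))"
      by (simp add: legal_pattern_iff[OF S aCG])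
    then show ?thesis
      using b(1) by blast
  qed
qed

lemma legal_pattern_extend:
  assumes S: "S \<subseteq> carrier G"
    and conv: "convexoid G \<C>" and ucp: "UCP G S \<C>" and tep: "TEP G \<C> S A k T"
    and A: "A \<noteq> {}" and k: "k \<ge> 1"
    and "C \<in> \<C>" and D: "D \<in> \<C>" and "C \<subseteq> D"
    and "P \<in> C \<rightarrow>\<^sub>E A" and "legal_pattern G S T C P"
  shows "\<exists>Q \<in> D \<rightarrow>\<^sub>E A. legal_pattern G S T D Q \<and> restrict Q C = P"
  using assms(7,9-)
proof (induction "card (D - C)" arbitrary: C P rule: less_induct)
  case less
  show ?case
  proof (cases "C = D")
    case True
    then show ?thesis
      using less.prems by (auto intro!: bexI[of _ P])
  next
    case False
    then have "\<exists>a\<in>D - C. C \<union> {a} \<in> \<C>"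
      using conv less.prems(1,2) D unfolding convexoid_def by blast
    then obtain a where a: "a \<in> D - C" "insert a C \<in> \<C>"
      by auto
    then obtain b where b: "b \<in> A" "legal_pattern G S T (insert a C) (P(a := b))"
      using legal_pattern_extend_cell[OF S conv ucp tep A k, of C a P] less.prems by blast
    have "D - insert a C \<subset> D - C"
      using a by blast
    moreover have "finite D"
      using convexoid_finite[OF conv D] .
    ultimately have "card (D - insert a C) < card (D - C)"
      by (intro psubset_card_mono) auto
    moreover have "P(a := b) \<in> insert a C \<rightarrow>\<^sub>E A"
      using less.prems b(1) by (intro PiE_fun_upd) auto
    ultimately obtain Q where Q: "Q \<in> D \<rightarrow>\<^sub>E A" "legal_pattern G S T D Q"
        "restrict Q (insert a C) = P(a := b)"
      using less.hyps[of "insert a C" "P(a := b)"] a b less.prems by blast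
    have "restrict Q C = restrict (restrict Q (insert a C)) C"
      by (simp add: Int_absorb1 subset_insertI)
    also have "\<dots> = restrict P C"
      using Q(3) a by (auto intro: restrict_ext)
    finally have "restrict Q C = P"
      using less.prems by simp
    then show ?thesis
      using Q by blast
  qed
qed

text \<open>
  Convex sets are cofinal among the finite subsets of the group, so a countable group is the union
  of an increasing chain of them. A configuration is the union of successive extensions along
  such a chain; every translate of the finite shape already lies in some member of the chain.
\<close>

lemma legal_pattern_extend_SFT:
  fixes A :: "'c set"
  assumes cnt: "countable (carrier G)"
    and S: "S \<subseteq> carrier G" and finS: "finite S"
    and conv: "convexoid G \<C>" and ucp: "UCP G S \<C>" and tep: "TEP G \<C> S A k T"
    and A: "A \<noteq> {}" and k: "k \<ge> 1"
    and C: "C \<in> \<C>" and P: "P \<in> C \<rightarrow>\<^sub>E A" and legal: "legal_pattern G S T C P"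
  shows "\<exists>x\<in>SFT G S A T. restrict x C = P"
proof -
  define ok where "ok = (\<lambda>(D, Q). D \<in> \<C> \<and> Q \<in> D \<rightarrow>\<^sub>E A \<and> legal_pattern G S T D Q)"
  define nxt where "nxt = (\<lambda>n (D, Q) (D', Q' :: 'a \<Rightarrow> 'c).
    from_nat_into (carrier G) n \<in> D' \<and> D \<subseteq> D' \<and> restrict Q' D = Q)"
  have ne: "carrier G \<noteq> {}"
    using one_closed by blast
  \<comment> \<open>The clause for \<open>n = 0\<close> pins the start of the chain, which dependent choice leaves open.\<close>
  have "\<exists>w. \<forall>n. (ok (w n) \<and> (n = 0 \<longrightarrow> w n = (C, P))) \<and> nxt n (w n) (w (Suc n))"
  proof (rule dependent_nat_choice)
    show "\<exists>u. ok u \<and> ((0::nat) = 0 \<longrightarrow> u = (C, P))"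
      using C P legal by (auto simp: ok_def)
  next
    fix u and n :: nat
    assume u: "ok u \<and> (n = 0 \<longrightarrow> u = (C, P))"
    obtain D Q where DQ: "u = (D, Q)"
      by (cases u)
    have D: "D \<in> \<C>" "Q \<in> D \<rightarrow>\<^sub>E A" "legal_pattern G S T D Q"
      using u by (auto simp: DQ ok_def)
    have "finite (insert (from_nat_into (carrier G) n) D)"
        "insert (from_nat_into (carrier G) n) D \<subseteq> carrier G"
      using convexoid_finite[OF conv D(1)] convexoid_subset[OF conv D(1)] from_nat_into[OF ne]
      by simp_all
    then obtain D' where D': "D' \<in> \<C>" "insert (from_nat_into (carrier G) n) D \<subseteq> D'"
      using convexoid_cofinal[OF conv] by blast
    then obtain Q' where "Q' \<in> D' \<rightarrow>\<^sub>E A" "legal_pattern G S T D' Q'" "restrict Q' D = Q"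
      using legal_pattern_extend[OF S conv ucp tep A k D(1), of D' Q] D by blast
    then show "\<exists>v. (ok v \<and> (Suc n = 0 \<longrightarrow> v = (C, P))) \<and> nxt n u v"
      using D' by (auto simp: DQ ok_def nxt_def)
  qed
  then obtain w where w: "\<And>n. ok (w n)" "w 0 = (C, P)" "\<And>n. nxt n (w n) (w (Suc n))"
    by blast
  define D where "D = (\<lambda>n. fst (w n))"
  define Q where "Q = (\<lambda>n. snd (w n))"
  have D0: "D 0 = C" "Q 0 = P"
    using w(2) by (auto simp: D_def Q_def)
  have DG: "D n \<subseteq> carrier G" and Qf: "Q n \<in> D n \<rightarrow>\<^sub>E A"
    and leg: "legal_pattern G S T (D n) (Q n)" for n
    using w(1)[of n] convexoid_subset[OF conv, of "D n"]
    by (auto simp: ok_def D_def Q_def split: prod.splits)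
  have DS: "D n \<subseteq> D (Suc n)" and hit: "from_nat_into (carrier G) n \<in> D (Suc n)"
    and QS: "restrict (Q (Suc n)) (D n) = Q n" for n
    using w(3)[of n] by (auto simp: nxt_def D_def Q_def split: prod.splits)
  have mono: "D i \<subseteq> D j" if "i \<le> j" for i j
    using that DS by (rule lift_Suc_mono_le[rotated])
  have agree: "Q j h = Q i h" if "i \<le> j" "h \<in> D i" for i j h
    using that(1)
  proof (induction j rule: dec_induct)
    case (step j)
    have "h \<in> D j"
      using mono[OF step(1)] that(2) by blast
    then show ?case
      using QS[of j] step by (metis restrict_apply')
  qed simp
  have "\<exists>n. h \<in> D n" if "h \<in> carrier G" for h
    using hit from_nat_into_surj[OF cnt that] by metis
  then obtain N where N: "\<And>h. h \<in> carrier G \<Longrightarrow> h \<in> D (N h)"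
    by metis
  define x where "x = (\<lambda>h\<in>carrier G. Q (N h) h)"
  have x_eq: "x h = Q n h" if "h \<in> D n" for h n
  proof -
    have "h \<in> carrier G"
      using DG that by blast
    then have "x h = Q (N h) h"
      by (simp add: x_def)
    also have "\<dots> = Q n h"
      using agree[of "N h" n h] agree[of n "N h" h] N[OF \<open>h \<in> carrier G\<close>] that
      by (metis nat_le_linear)
    finally show ?thesis .
  qed
  have "x \<in> carrier G \<rightarrow>\<^sub>E A"
    using N Qf by (fastforce simp: x_def)
  moreover have "(\<lambda>s\<in>S. x (g \<otimes> s)) \<in> T" if g: "g \<in> carrier G" for g
  proof -
    define n where "n = Max ((\<lambda>s. N (g \<otimes> s)) ` S)"
    have inD: "g \<otimes> s \<in> D n" if "s \<in> S" for s
    proof -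
      have "N (g \<otimes> s) \<le> n"
        using that finS by (simp add: n_def)
      then show ?thesis
        using mono N g S that by (meson m_closed subsetD)
    qed
    then have "(\<lambda>s\<in>S. x (g \<otimes> s)) = (\<lambda>s\<in>S. Q n (g \<otimes> s))"
      using x_eq by (auto intro: restrict_ext)
    then show ?thesis
      using leg[of n] inD g by (simp add: legal_pattern_iff[OF S DG])
  qed
  ultimately have "x \<in> SFT G S A T"
    by (simp add: SFT_iff_legal[OF S] legal_pattern_iff[OF S])
  moreover have "restrict x C = restrict P C"
    using x_eq[of _ 0] by (intro restrict_ext) (simp add: D0)
  then have "restrict x C = P"
    using P by simp
  ultimately show ?thesis
    by blast
qed

text \<open>
  This turns the existence of an infinite configuration into a question about the finitely many
  patterns on a convex superset of the domain.
\<close>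

lemma occurs_in_SFT_iff:
  assumes "countable (carrier G)" and S: "S \<subseteq> carrier G" and "finite S"
    and conv: "convexoid G \<C>" and "UCP G S \<C>" and "TEP G \<C> S A k T"
    and "A \<noteq> {}" and "k \<ge> 1" and D: "D \<in> \<C>" and CD: "C \<subseteq> D"
  shows "occurs_in C P (SFT G S A T) \<longleftrightarrow>
    (\<exists>Q \<in> D \<rightarrow>\<^sub>E A. legal_pattern G S T D Q \<and> restrict Q C = P)"
proof
  have DG: "D \<subseteq> carrier G"
    using convexoid_subset[OF conv D] .
  assume "occurs_in C P (SFT G S A T)"
  then obtain x where x: "x \<in> SFT G S A T" "P = restrict x C"
    by (auto simp: occurs_in_def)
  then have "restrict x D \<in> D \<rightarrow>\<^sub>E A" "legal_pattern G S T D (restrict x D)"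
    using DG S by (auto simp: SFT_iff_legal intro: legal_pattern_restrict)
  moreover have "restrict (restrict x D) C = P"
    using CD x(2) by (simp add: Int_absorb1)
  ultimately show "\<exists>Q \<in> D \<rightarrow>\<^sub>E A. legal_pattern G S T D Q \<and> restrict Q C = P"
    by blast
next
  assume "\<exists>Q \<in> D \<rightarrow>\<^sub>E A. legal_pattern G S T D Q \<and> restrict Q C = P"
  then obtain Q where Q: "Q \<in> D \<rightarrow>\<^sub>E A" "legal_pattern G S T D Q" "restrict Q C = P"
    by blast
  then obtain x where "x \<in> SFT G S A T" "restrict x D = Q"
    using legal_pattern_extend_SFT[OF assms(1-9)] by blast
  moreover from this have "P = restrict x C"
    using Q(3) CD by (auto simp: Int_absorb1)
  ultimately show "occurs_in C P (SFT G S A T)"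
    by (auto simp: occurs_in_def)
qed

text \<open>
  A translate of the shape inside \<open>D\<close> is determined by the cell \<open>x\<close> of \<open>D\<close> on which a
  chosen base point \<open>s\<^sub>0\<close> lands. Its cells arise from \<open>x\<close> by right multiplication
  with fixed group elements, so legality can be tested cell by cell without searching for \<open>g\<close>.
\<close>

lemma legal_pattern_iff_base_point:
  assumes S: "S \<subseteq> carrier G" and D: "D \<subseteq> carrier G" and T: "T \<subseteq> S \<rightarrow>\<^sub>E A" and s0: "s\<^sub>0 \<in> S"
  shows "legal_pattern G S T D Q \<longleftrightarrow>
    (\<forall>x\<in>D. (\<forall>s\<in>S. x \<otimes> (inv s\<^sub>0 \<otimes> s) \<in> D) \<longrightarrow>
      (\<exists>t\<in>T. \<forall>s\<in>S. Q (x \<otimes> (inv s\<^sub>0 \<otimes> s)) = t s))"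
proof -
  have mem: "(\<exists>t\<in>T. \<forall>s\<in>S. f s = t s) \<longleftrightarrow> restrict f S \<in> T" for f
  proof
    assume "\<exists>t\<in>T. \<forall>s\<in>S. f s = t s"
    then obtain t where t: "t \<in> T" "\<forall>s\<in>S. f s = t s"
      by blast
    then have "restrict f S = restrict t S"
      by (intro restrict_ext) blast
    also have "\<dots> = t"
      using T t(1) by (blast intro: PiE_restrict)
    finally have "restrict f S = t" .
    then show "restrict f S \<in> T"
      using t by simp
  next
    assume "restrict f S \<in> T"
    then show "\<exists>t\<in>T. \<forall>s\<in>S. f s = t s"
      by (intro bexI[of _ "restrict f S"]) auto
  qed
  have s0G: "s\<^sub>0 \<in> carrier G"
    using s0 S by blast
  have tr: "x \<otimes> (inv s\<^sub>0 \<otimes> s) = (x \<otimes> inv s\<^sub>0) \<otimes> s" if "x \<in> carrier G" "s \<in> S" for x s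
    using that s0G S by (simp add: m_assoc subset_iff)
  have "legal_pattern G S T D Q \<longleftrightarrow>
    (\<forall>g\<in>carrier G. (\<forall>s\<in>S. g \<otimes> s \<in> D) \<longrightarrow> (\<exists>t\<in>T. \<forall>s\<in>S. Q (g \<otimes> s) = t s))"
    by (simp add: legal_pattern_iff[OF S D] mem)
  also have "\<dots> \<longleftrightarrow> (\<forall>x\<in>D. (\<forall>s\<in>S. (x \<otimes> inv s\<^sub>0) \<otimes> s \<in> D) \<longrightarrow>
      (\<exists>t\<in>T. \<forall>s\<in>S. Q ((x \<otimes> inv s\<^sub>0) \<otimes> s) = t s))" (is "?L \<longleftrightarrow> ?R")
  proof
    assume L: ?L
    have "x \<otimes> inv s\<^sub>0 \<in> carrier G" if "x \<in> D" for x
      using that D s0G by blast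
    then show ?R
      using L by blast
  next
    assume R: ?R
    show ?L
    proof (intro ballI impI)
      fix g assume g: "g \<in> carrier G" "\<forall>s\<in>S. g \<otimes> s \<in> D"
      have "(g \<otimes> s\<^sub>0) \<otimes> inv s\<^sub>0 = g"
        using g(1) s0G by (simp add: m_assoc)
      then show "\<exists>t\<in>T. \<forall>s\<in>S. Q (g \<otimes> s) = t s"
        using bspec[OF R, of "g \<otimes> s\<^sub>0"] g(2) s0 by simp
    qed
  qed
  also have "\<dots> \<longleftrightarrow> (\<forall>x\<in>D. (\<forall>s\<in>S. x \<otimes> (inv s\<^sub>0 \<otimes> s) \<in> D) \<longrightarrow>
      (\<exists>t\<in>T. \<forall>s\<in>S. Q (x \<otimes> (inv s\<^sub>0 \<otimes> s)) = t s))"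
    using D by (intro ball_cong refl) (simp add: tr subset_iff)
  finally show ?thesis .
qed

end

section \<open>Recursive functions and decidable predicates\<close>

definition recursive :: "(nat \<Rightarrow> nat) \<Rightarrow> bool" where
  "recursive f \<longleftrightarrow> partial_recursive (\<lambda>n. Some (f n))"

abbreviation decidable :: "(nat \<Rightarrow> bool) \<Rightarrow> bool" where
  "decidable P \<equiv> decidable_set {n. P n}"

abbreviation proj1 :: "nat \<Rightarrow> nat" where
  "proj1 n \<equiv> fst (prod_decode n)"

abbreviation proj2 :: "nat \<Rightarrow> nat" where
  "proj2 n \<equiv> snd (prod_decode n)"

lemma decidable_iff: "decidable P \<longleftrightarrow> recursive (\<lambda>n. if P n then 1 else 0)"
proof
  assume "decidable P"
  then obtain f where f: "partial_recursive f" "\<And>n. f n = Some (if P n then 1 else 0)"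
    by (auto simp: decidable_set_def)
  then have "f = (\<lambda>n. Some (if P n then 1 else 0))"
    by blast
  then show "recursive (\<lambda>n. if P n then 1 else 0)"
    using f(1) by (simp add: recursive_def)
next
  assume "recursive (\<lambda>n. if P n then 1 else 0)"
  then show "decidable P"
    unfolding decidable_set_def recursive_def
    by (intro exI[of _ "\<lambda>n. Some (if P n then 1 else 0)"]) simp
qed

text \<open>
  The closure rules below are stated for functions and predicates of one argument \<open>n\<close> applied to
  subterms depending on \<open>n\<close>, so that a recursiveness proof follows the syntax of the term.
  Bound variables are turned into components of a pair, as in the rules for primitive
  recursion and bounded quantification.
\<close>

lemma recursive_comp: "recursive f \<Longrightarrow> recursive g \<Longrightarrow> recursive (\<lambda>n. f (g n))"
  unfolding recursive_def using partial_recursive.comp[of "\<lambda>n. Some (f n)" "\<lambda>n. Some (g n)"]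
  by simp

lemma recursive_Suc: "recursive f \<Longrightarrow> recursive (\<lambda>n. Suc (f n))"
  using recursive_comp[of Suc f] partial_recursive.succ by (simp add: recursive_def)

lemma recursive_proj1: "recursive f \<Longrightarrow> recursive (\<lambda>n. proj1 (f n))"
  using recursive_comp[of proj1 f] partial_recursive.left by (simp add: recursive_def)

lemma recursive_proj2: "recursive f \<Longrightarrow> recursive (\<lambda>n. proj2 (f n))"
  using recursive_comp[of proj2 f] partial_recursive.right by (simp add: recursive_def)

lemma recursive_pair:
  "recursive f \<Longrightarrow> recursive g \<Longrightarrow> recursive (\<lambda>n. prod_encode (f n, g n))"
  unfolding recursive_def
  using partial_recursive.pair[of "\<lambda>n. Some (f n)" "\<lambda>n. Some (g n)"] by simp

lemma recursive_id: "recursive (\<lambda>n. n)"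
  using recursive_pair[of proj1 proj2] partial_recursive.left partial_recursive.right
  by (simp add: recursive_def)

lemma recursive_const: "recursive (\<lambda>n. c)"
proof (induction c)
  case 0
  then show ?case
    using partial_recursive.zero by (simp add: recursive_def)
qed (rule recursive_Suc)

lemma recursive_rec_nat:
  assumes b: "recursive b" and m: "recursive m"
    and s: "recursive (\<lambda>z. s (proj1 z) (proj1 (proj2 z)) (proj2 (proj2 z)))"
  shows "recursive (\<lambda>n. rec_nat (b n) (s n) (m n))"
proof -
  define s' where "s' = (\<lambda>z. s (proj1 z) (proj1 (proj2 z)) (proj2 (proj2 z)))"
  have "rec_nat (Some (b a)) (\<lambda>i r. Option.bind r (\<lambda>v. Some (s' (prod_encode (a, prod_encode (i, v)))))) k
      = Some (rec_nat (b a) (s a) k)" for a k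
    by (induction k) (simp_all add: s'_def)
  then have "partial_recursive (\<lambda>n. case prod_decode n of (a, k) \<Rightarrow> Some (rec_nat (b a) (s a) k))"
    using partial_recursive.prec[of "\<lambda>n. Some (b n)" "\<lambda>z. Some (s' z)"] b s
    by (simp add: recursive_def s'_def)
  then have "recursive (\<lambda>n. rec_nat (b (proj1 n)) (s (proj1 n)) (proj2 n))"
    by (simp add: recursive_def case_prod_unfold)
  from recursive_comp[OF this recursive_pair[OF recursive_id m]] show ?thesis
    by simp
qed

lemma recursive_If:
  assumes "decidable P" "recursive f" "recursive g"
  shows "recursive (\<lambda>n. if P n then f n else g n)"
proof -
  have "recursive (\<lambda>z. f (proj1 z))"
    by (intro recursive_comp[OF assms(2)] recursive_proj1 recursive_id)
  then have "recursive (\<lambda>n. rec_nat (g n) (\<lambda>_ _. f n) (if P n then 1 else 0))"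
    using assms by (intro recursive_rec_nat) (simp_all add: decidable_iff)
  moreover have "rec_nat (g n) (\<lambda>_ _. f n) (if P n then 1 else 0) = (if P n then f n else g n)" for n
    by simp
  ultimately show ?thesis
    by simp
qed

lemma decidable_comp: "decidable P \<Longrightarrow> recursive f \<Longrightarrow> decidable (\<lambda>n. P (f n))"
  unfolding decidable_iff by (rule recursive_comp)

lemma decidable_const: "decidable (\<lambda>n. b)"
  unfolding decidable_iff by (cases b) (simp_all add: recursive_const)

lemma decidable_Not:
  assumes "decidable P"
  shows "decidable (\<lambda>n. \<not> P n)"
proof -
  have "recursive (\<lambda>n. if P n then 0 else 1)"
    by (intro recursive_If assms recursive_const)
  moreover have "(if P n then 0 else 1) = (if \<not> P n then 1 else 0 :: nat)" for n
    by simp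
  ultimately show ?thesis
    by (simp add: decidable_iff)
qed

lemma decidable_conj:
  assumes "decidable P" "decidable Q"
  shows "decidable (\<lambda>n. P n \<and> Q n)"
proof -
  have "recursive (\<lambda>n. if P n then if Q n then 1 else 0 else 0)"
    by (intro recursive_If assms recursive_const)
  moreover have "(if P n then if Q n then 1 else 0 else 0) = (if P n \<and> Q n then 1 else 0 :: nat)" for n
    by simp
  ultimately show ?thesis
    by (simp add: decidable_iff)
qed

lemma decidable_imp:
  assumes "decidable P" "decidable Q"
  shows "decidable (\<lambda>n. P n \<longrightarrow> Q n)"
  using decidable_Not[OF decidable_conj[OF assms(1) decidable_Not[OF assms(2)]]] by simp

lemma decidable_bounded_Ex:
  assumes P: "decidable (\<lambda>z. P (proj1 z) (proj2 z))" and b: "recursive b"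
  shows "decidable (\<lambda>n. \<exists>i<b n. P n i)"
proof -
  have "decidable (\<lambda>z. P (proj1 z) (proj1 (proj2 z)))"
    using decidable_comp[OF P, of "\<lambda>z. prod_encode (proj1 z, proj1 (proj2 z))"]
    by (simp add: recursive_pair recursive_proj1 recursive_proj2 recursive_id)
  then have "recursive (\<lambda>n. rec_nat 0 (\<lambda>i v. if P n i then 1 else v) (b n))"
    by (intro recursive_rec_nat b recursive_If recursive_const recursive_proj2 recursive_id)
  moreover have "rec_nat 0 (\<lambda>i v. if P n i then 1 else v) k = (if \<exists>i<k. P n i then 1 else 0 :: nat)"
    for n k by (induction k) (auto simp: less_Suc_eq)
  ultimately show ?thesis
    by (simp add: decidable_iff)
qed

lemma decidable_bounded_All:
  assumes "decidable (\<lambda>z. P (proj1 z) (proj2 z))" and "recursive b"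
  shows "decidable (\<lambda>n. \<forall>i<b n. P n i)"
  using decidable_Not[OF decidable_bounded_Ex[OF decidable_Not[OF assms(1)] assms(2)]] by simp

lemma decidable_finite_Ball:
  assumes "finite F" "\<And>i. i \<in> F \<Longrightarrow> decidable (P i)"
  shows "decidable (\<lambda>n. \<forall>i\<in>F. P i n)"
  using assms by (induction F rule: finite_induct) (simp_all add: decidable_const[of True, simplified] decidable_conj)

lemma decidable_finite_Bex:
  assumes "finite F" "\<And>i. i \<in> F \<Longrightarrow> decidable (P i)"
  shows "decidable (\<lambda>n. \<exists>i\<in>F. P i n)"
  using decidable_Not[OF decidable_finite_Ball[OF assms(1) decidable_Not[OF assms(2)]]] by simp

lemma partial_recursive_Least:
  assumes "decidable (\<lambda>z. P (proj1 z) (proj2 z))"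
  shows "partial_recursive (\<lambda>n. if \<exists>i. P n i then Some (LEAST i. P n i) else None)"
proof -
  let ?f = "\<lambda>z. Some (if P (proj1 z) (proj2 z) then 0 else 1)"
  have "partial_recursive ?f"
    using recursive_If[OF assms recursive_const recursive_const, of 0 1] by (simp add: recursive_def)
  moreover have "Some (if b then 0 else 1) = Some (0::nat) \<longleftrightarrow> b"
    "(\<exists>v. Some (if b then 0 else 1) = Some (Suc v)) \<longleftrightarrow> \<not> b" for b
    by simp_all
  ultimately have "partial_recursive (\<lambda>n. if \<exists>m. P n m \<and> (\<forall>i<m. \<not> P n i)
      then Some (LEAST m. P n m) else None)"
    using partial_recursive.minim[of ?f] by (simp only: prod_encode_inverse fst_conv snd_conv)
  moreover have "(\<exists>m. P n m \<and> (\<forall>i<m. \<not> P n i)) \<longleftrightarrow> (\<exists>m. P n m)" for n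
    using LeastI_ex[of "P n"] not_less_Least[of _ "P n"] by blast
  ultimately show ?thesis
    by simp
qed

text \<open>
  Primitive recursion with the truth value as recursion argument is a lazy conditional: the partial
  function is not evaluated outside the decidable set. Hence a partial recursive function that is
  known only on a decidable set of codes has a total recursive extension.
\<close>

lemma recursive_extension:
  assumes f: "partial_recursive f" and N: "decidable_set N"
    and g: "\<And>n. n \<in> N \<Longrightarrow> f n = Some (g n)"
  shows "recursive (\<lambda>n. if n \<in> N then g n else 0)"
proof -
  let ?chi = "\<lambda>n. Some (if n \<in> N then 1 else 0)"
  have "partial_recursive (\<lambda>z. Option.bind (Some (proj1 z)) f)"
    by (intro partial_recursive.comp f partial_recursive.left)
  from partial_recursive.prec[OF partial_recursive.zero this]
  have 1: "partial_recursive (\<lambda>n. case prod_decode n of (a, m) \<Rightarrow>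
      rec_nat (Some 0) (\<lambda>i r. Option.bind r (\<lambda>v. f a)) m)"
    by simp
  have "recursive (\<lambda>n. prod_encode (n, if n \<in> N then 1 else 0))"
    using N decidable_iff[of "\<lambda>n. n \<in> N"] by (intro recursive_pair recursive_id) simp
  from partial_recursive.comp[OF 1 this[unfolded recursive_def]]
  have "partial_recursive (\<lambda>n. rec_nat (Some 0) (\<lambda>i r. Option.bind r (\<lambda>v. f n)) (if n \<in> N then 1 else 0))"
    by simp
  moreover have "rec_nat (Some 0) (\<lambda>i r. Option.bind r (\<lambda>v. f n)) (if n \<in> N then 1 else 0)
      = Some (if n \<in> N then g n else 0)" for n
    by (simp add: g)
  ultimately show ?thesis
    by (simp add: recursive_def)
qed

lemma recursive_power_2:
  assumes "recursive f"
  shows "recursive (\<lambda>n. 2 ^ f n)"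
proof -
  have dbl: "recursive (\<lambda>n. rec_nat n (\<lambda>_ v. Suc v) n)"
    by (intro recursive_rec_nat recursive_id recursive_Suc recursive_proj2)
  have eq: "rec_nat k (\<lambda>_ v. Suc v) n = k + n" for k n :: nat
    by (induction n) auto
  have "recursive (\<lambda>n. rec_nat 1 (\<lambda>_ v. rec_nat v (\<lambda>_ v. Suc v) v) (f n))"
    by (intro recursive_rec_nat[where b = "\<lambda>_. 1"] recursive_const assms
        recursive_comp[OF dbl] recursive_proj2 recursive_id)
  moreover have "rec_nat 1 (\<lambda>_ v. rec_nat v (\<lambda>_ v. Suc v) v) m = (2 ^ m :: nat)" for m
    by (induction m) (auto simp: eq)
  ultimately show ?thesis
    by simp
qed

text \<open>
  Membership in the finite set with a given canonical index is a test of a binary digit. Successive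
  halving is primitive recursive because the parity of the argument is.
\<close>

lemma decidable_mem_set_decode:
  assumes f: "recursive f" and g: "recursive g"
  shows "decidable (\<lambda>n. f n \<in> set_decode (g n))"
proof -
  have pos: "decidable (\<lambda>n. 0 < n)"
  proof -
    have "recursive (\<lambda>n. rec_nat 0 (\<lambda>_ _. 1) n)"
      by (intro recursive_rec_nat recursive_const recursive_id)
    moreover have "rec_nat 0 (\<lambda>_ _. 1) n = (if 0 < n then 1 else 0 :: nat)" for n
      by (cases n) auto
    ultimately show ?thesis
      by (simp add: decidable_iff)
  qed
  have odd: "decidable (\<lambda>n. odd n)"
  proof -
    have "recursive (\<lambda>n. rec_nat 0 (\<lambda>_ v. if 0 < v then 0 else 1) n)"
      by (intro recursive_rec_nat recursive_If recursive_const recursive_id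
          decidable_comp[OF pos] recursive_proj2)
    moreover have "rec_nat 0 (\<lambda>_ v. if 0 < v then 0 else 1) n = (if odd n then 1 else 0 :: nat)" for n
      by (induction n) auto
    ultimately show ?thesis
      by (simp add: decidable_iff)
  qed
  have half: "recursive (\<lambda>n. n div 2)"
  proof -
    have "recursive (\<lambda>n. rec_nat 0 (\<lambda>i v. if odd i then Suc v else v) n)"
      by (intro recursive_rec_nat recursive_If recursive_const recursive_id recursive_Suc
          decidable_comp[OF odd] recursive_proj1 recursive_proj2)
    moreover have "rec_nat 0 (\<lambda>i v. if odd i then Suc v else v) n = n div 2" for n :: nat
      by (induction n) auto
    ultimately show ?thesis
      by simp
  qed
  have "recursive (\<lambda>n. rec_nat (g n) (\<lambda>_ v. v div 2) (f n))"
    by (intro recursive_rec_nat f g recursive_comp[OF half] recursive_proj2 recursive_id)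
  moreover have "rec_nat m (\<lambda>_ v. v div 2) k = m div 2 ^ k" for m k :: nat
    by (induction k) (auto simp: div_mult2_eq[symmetric] mult.commute)
  ultimately have "decidable (\<lambda>n. odd (g n div 2 ^ f n))"
    by (intro decidable_comp[OF odd]) simp
  then show ?thesis
    by (simp add: set_decode_def)
qed

lemma mem_set_decode_less:
  assumes "i \<in> set_decode n"
  shows "i < n"
proof -
  have "2 ^ i \<le> n"
    using assms by (auto simp: set_decode_def intro: ccontr)
  then show ?thesis
    using less_exp[of i] by linarith
qed

lemma decidable_Ball_set_decode:
  assumes P: "decidable (\<lambda>z. P (proj1 z) (proj2 z))" and g: "recursive g"
  shows "decidable (\<lambda>n. \<forall>i\<in>set_decode (g n). P n i)"
proof -
  have "recursive (\<lambda>z. g (proj1 z))"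
    by (intro recursive_comp[OF g] recursive_proj1 recursive_id)
  then have "decidable (\<lambda>n. \<forall>i<g n. i \<in> set_decode (g n) \<longrightarrow> P n i)"
    by (intro decidable_bounded_All decidable_imp decidable_mem_set_decode P g
        recursive_proj2 recursive_id)
  moreover have "(\<forall>i<g n. i \<in> set_decode (g n) \<longrightarrow> P n i) \<longleftrightarrow> (\<forall>i\<in>set_decode (g n). P n i)" for n
    using mem_set_decode_less by blast
  ultimately show ?thesis
    by simp
qed

lemma set_encode_less_power:
  assumes "N \<subseteq> {..<b}"
  shows "set_encode N < 2 ^ b"
proof -
  have "finite N"
    using assms finite_subset by blast
  then have "set_encode N \<le> set_encode {..<b}"
    using assms by (intro subset_decode_imp_le) simp
  also have "\<dots> = 2 ^ b - 1"
    by (simp add: set_encode_def mask_eq_sum_exp_nat[symmetric] lessThan_def)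
  finally have "set_encode N \<le> 2 ^ b - 1" .
  moreover have "(0::nat) < 2 ^ b"
    by simp
  ultimately show ?thesis
    by linarith
qed

lemma prod_encode_mono:
  assumes "a \<le> c" "b \<le> d"
  shows "prod_encode (a, b) \<le> prod_encode (c, d)"
proof -
  have "triangle (a + b) \<le> triangle (c + d)"
    unfolding triangle_def using assms by (intro div_le_mono mult_le_mono) simp_all
  then show ?thesis
    using assms(1) by (simp add: prod_encode_def)
qed

section \<open>Deciding the language\<close>

text \<open>
  Here \<open>q\<close> is the code of a candidate pattern, \<open>d\<close> of its domain, \<open>p\<close> of the pattern to be
  extended and \<open>\<tau>\<close> of the set of allowed patterns; \<open>r s\<close> computes the cell for
  \<open>s\<close> of the translate with given base cell. The first conjunct makes \<open>q\<close> single-valued on the domain. Junk in \<open>q\<close>, such as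
  pairs outside the domain or numbers that code no symbol, is tolerated: a bounded search runs
  over all numbers, and discarding the junk leaves a genuine pattern that passes the same test.
\<close>

definition codes_legal_extension ::
  "'a set \<Rightarrow> ('a \<Rightarrow> nat) \<Rightarrow> 'g set \<Rightarrow> ('g \<Rightarrow> nat \<Rightarrow> nat) \<Rightarrow> (('g \<Rightarrow> 'a) \<Rightarrow> nat) \<Rightarrow>
    nat \<Rightarrow> nat \<Rightarrow> nat \<Rightarrow> nat \<Rightarrow> bool" where
  "codes_legal_extension A \<alpha> S r \<pi> \<tau> p d q \<longleftrightarrow>
     (\<forall>x\<in>set_decode d. \<exists>a\<in>A. prod_encode (x, \<alpha> a) \<in> set_decode q \<and>
        (\<forall>b\<in>A - {a}. prod_encode (x, \<alpha> b) \<notin> set_decode q)) \<and>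
     (\<forall>z\<in>set_decode p. z \<in> set_decode q) \<and>
     (\<forall>x\<in>set_decode d. (\<forall>s\<in>S. r s x \<in> set_decode d) \<longrightarrow>
        (\<exists>t\<in>S \<rightarrow>\<^sub>E A. \<pi> t \<in> set_decode \<tau> \<and>
           (\<forall>s\<in>S. prod_encode (r s x, \<alpha> (t s)) \<in> set_decode q)))"

lemma decidable_codes_legal_extension:
  assumes "finite A" "finite S" and r: "\<And>s. s \<in> S \<Longrightarrow> recursive (r s)"
    and \<tau>: "recursive \<tau>" and p: "recursive p" and d: "recursive d" and q: "recursive q"
  shows "decidable (\<lambda>n. codes_legal_extension A \<alpha> S r \<pi> (\<tau> n) (p n) (d n) (q n))"
  unfolding codes_legal_extension_def
  using assms(1,2)
  by (intro decidable_conj decidable_imp decidable_Not decidable_Ball_set_decode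
      decidable_finite_Ball decidable_finite_Bex finite_PiE finite_Diff
      decidable_mem_set_decode recursive_pair recursive_const
      recursive_comp[OF r] recursive_comp[OF \<tau>] recursive_comp[OF p]
      recursive_comp[OF d] recursive_comp[OF q]
      recursive_proj1 recursive_proj2 recursive_id)

lemma inj_on_elt_code: "inj_on code X \<Longrightarrow> inj_on (elt_code code) X"
  by (auto simp: inj_on_def elt_code_def list_encode_eq)

lemma mem_pattern_code_iff:
  assumes "inj_on code X" "C \<subseteq> X" "finite C" "inj_on \<alpha> A" "P \<in> C \<rightarrow>\<^sub>E A" "h \<in> X" "a \<in> A"
  shows "prod_encode (elt_code code h, \<alpha> a) \<in> set_decode (pattern_code code \<alpha> C P) \<longleftrightarrow>
    h \<in> C \<and> P h = a"
proof -
  have "elt_code code h = elt_code code g \<longleftrightarrow> h = g" if "g \<in> C" for g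
    using inj_on_eq_iff[OF inj_on_elt_code[OF assms(1)]] that assms(2,6) by blast
  moreover have "\<alpha> a = \<alpha> (P g) \<longleftrightarrow> a = P g" if "g \<in> C" for g
    using inj_on_eq_iff[OF assms(4)] that assms(5,7) by blast
  ultimately show ?thesis
    using assms(3) by (auto simp: pattern_code_def image_iff)
qed

lemma inj_on_pattern_code:
  assumes "inj_on code C" "finite C" "inj_on \<alpha> A"
  shows "inj_on (pattern_code code \<alpha> C) (C \<rightarrow>\<^sub>E A)"
proof (rule inj_onI)
  fix P Q assume P: "P \<in> C \<rightarrow>\<^sub>E A" and Q: "Q \<in> C \<rightarrow>\<^sub>E A"
    and eq: "pattern_code code \<alpha> C P = pattern_code code \<alpha> C Q"
  show "P = Q"
  proof (rule PiE_ext[OF P Q])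
    fix h assume h: "h \<in> C"
    then have "P h \<in> A"
      using P by blast
    then show "P h = Q h"
      using mem_pattern_code_iff[OF assms(1) subset_refl assms(2,3) P h, of "P h"]
        mem_pattern_code_iff[OF assms(1) subset_refl assms(2,3) Q h, of "P h"] h eq by simp
  qed
qed

context group
begin

lemma recursive_right_mult:
  assumes wp: "decidable_word_problem G m code" and c: "c \<in> carrier G"
  shows "\<exists>r. recursive r \<and> (\<forall>g\<in>carrier G. r (elt_code code g) = elt_code code (g \<otimes> c))"
proof -
  obtain f where f: "partial_recursive f"
    and fm: "\<And>g h. g \<in> carrier G \<Longrightarrow> h \<in> carrier G \<Longrightarrow>
      f (prod_encode (elt_code code g, elt_code code h)) = Some (elt_code code (g \<otimes> h))"
    using wp unfolding decidable_word_problem_def by blast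
  have N: "decidable_set (elt_code code ` carrier G)"
    using wp by (simp add: decidable_word_problem_def)
  define f' where "f' = (\<lambda>n. f (prod_encode (n, elt_code code c)))"
  have "recursive (\<lambda>n. prod_encode (n, elt_code code c))"
    by (intro recursive_pair recursive_id recursive_const)
  from partial_recursive.comp[OF f this[unfolded recursive_def]]
  have "partial_recursive f'"
    by (simp add: f'_def)
  moreover have "f' n = Some (the (f' n))" if "n \<in> elt_code code ` carrier G" for n
    using that fm c by (auto simp: f'_def)
  ultimately have "recursive (\<lambda>n. if n \<in> elt_code code ` carrier G then the (f' n) else 0)"
    by (rule recursive_extension[OF _ N])
  then show ?thesis
    using fm c by (intro exI conjI) (auto simp: f'_def)
qed

text \<open>
  The hypothesis on \<open>q\<close> says only that its digits represent \<open>Q\<close> on \<open>D\<close> and leaves the other digits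
  free. So the equivalence serves both for the code of \<open>Q\<close> and for an arbitrary number
  that passes the test.
\<close>

lemma codes_legal_extension_iff:
  assumes code: "inj_on code (carrier G)" and \<alpha>: "inj_on \<alpha> A"
    and S: "S \<subseteq> carrier G" "finite S" and s0: "s\<^sub>0 \<in> S" and A: "finite A"
    and T: "T \<subseteq> S \<rightarrow>\<^sub>E A" and D: "D \<subseteq> carrier G" "finite D" and CD: "C \<subseteq> D"
    and r: "\<And>s x. s \<in> S \<Longrightarrow> x \<in> carrier G \<Longrightarrow>
      r s (elt_code code x) = elt_code code (x \<otimes> (inv s\<^sub>0 \<otimes> s))"
    and P: "P \<in> C \<rightarrow>\<^sub>E A" and Q: "Q \<in> D \<rightarrow>\<^sub>E A"
    and q: "\<And>x a. x \<in> D \<Longrightarrow> a \<in> A \<Longrightarrow>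
      prod_encode (elt_code code x, \<alpha> a) \<in> set_decode q \<longleftrightarrow> Q x = a"
  shows "codes_legal_extension A \<alpha> S r (pattern_code code \<alpha> S) (family_code code \<alpha> S T)
      (pattern_code code \<alpha> C P) (finset_code code D) q \<longleftrightarrow>
    legal_pattern G S T D Q \<and> restrict Q C = P" (is "?L \<longleftrightarrow> _")
proof -
  have dom: "set_decode (finset_code code D) = elt_code code ` D"
    using D(2) by (simp add: finset_code_def)
  have memD: "elt_code code x \<in> elt_code code ` D \<longleftrightarrow> x \<in> D" if "x \<in> carrier G" for x
    using inj_on_image_mem_iff[OF inj_on_elt_code[OF code] that D(1)] .
  have "finite C"
    using CD D(2) finite_subset by blast
  then have graph: "set_decode (pattern_code code \<alpha> C P) =
      (\<lambda>g. prod_encode (elt_code code g, \<alpha> (P g))) ` C"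
    by (simp add: pattern_code_def)
  have "finite T"
    using T A S(2) finite_PiE finite_subset by metis
  moreover have "inj_on (pattern_code code \<alpha> S) (S \<rightarrow>\<^sub>E A)"
    using inj_on_pattern_code[OF inj_on_subset[OF code S(1)] S(2) \<alpha>] .
  ultimately have memT: "pattern_code code \<alpha> S t \<in> set_decode (family_code code \<alpha> S T) \<longleftrightarrow> t \<in> T"
    if "t \<in> S \<rightarrow>\<^sub>E A" for t
    using that T by (simp add: family_code_def inj_on_image_mem_iff)
  have cell: "x \<otimes> (inv s\<^sub>0 \<otimes> s) \<in> carrier G" if "x \<in> D" "s \<in> S" for x s
    using that s0 S(1) D(1) by (simp add: subset_iff)
  have rD: "r s (elt_code code x) = elt_code code (x \<otimes> (inv s\<^sub>0 \<otimes> s))" if "x \<in> D" "s \<in> S" for x s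
    using r that D(1) by blast
  have "\<forall>x\<in>D. \<exists>a\<in>A. prod_encode (elt_code code x, \<alpha> a) \<in> set_decode q \<and>
      (\<forall>b\<in>A - {a}. prod_encode (elt_code code x, \<alpha> b) \<notin> set_decode q)"
  proof
    fix x assume "x \<in> D"
    then show "\<exists>a\<in>A. prod_encode (elt_code code x, \<alpha> a) \<in> set_decode q \<and>
        (\<forall>b\<in>A - {a}. prod_encode (elt_code code x, \<alpha> b) \<notin> set_decode q)"
      using q Q by (intro bexI[of _ "Q x"]) auto
  qed
  moreover have "(\<forall>g\<in>C. prod_encode (elt_code code g, \<alpha> (P g)) \<in> set_decode q) \<longleftrightarrow> restrict Q C = P"
  proof -
    have "(\<forall>g\<in>C. prod_encode (elt_code code g, \<alpha> (P g)) \<in> set_decode q) \<longleftrightarrow> (\<forall>g\<in>C. Q g = P g)"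
      using q CD P by (intro ball_cong refl) blast
    also have "\<dots> \<longleftrightarrow> restrict Q C = restrict P C"
      by (metis restrict_apply' restrict_ext)
    finally show ?thesis
      using P by simp
  qed
  moreover have "(\<forall>x\<in>D. (\<forall>s\<in>S. r s (elt_code code x) \<in> elt_code code ` D) \<longrightarrow>
        (\<exists>t\<in>S \<rightarrow>\<^sub>E A. pattern_code code \<alpha> S t \<in> set_decode (family_code code \<alpha> S T) \<and>
           (\<forall>s\<in>S. prod_encode (r s (elt_code code x), \<alpha> (t s)) \<in> set_decode q))) \<longleftrightarrow>
      legal_pattern G S T D Q"
    unfolding legal_pattern_iff_base_point[OF S(1) D(1) T s0]
  proof (rule ball_cong[OF refl])
    fix x assume x: "x \<in> D"
    have "(\<forall>s\<in>S. r s (elt_code code x) \<in> elt_code code ` D) \<longleftrightarrow>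
        (\<forall>s\<in>S. x \<otimes> (inv s\<^sub>0 \<otimes> s) \<in> D)"
      using x cell by (intro ball_cong refl) (simp add: rD memD)
    moreover have "(\<exists>t\<in>S \<rightarrow>\<^sub>E A. pattern_code code \<alpha> S t \<in> set_decode (family_code code \<alpha> S T) \<and>
           (\<forall>s\<in>S. prod_encode (r s (elt_code code x), \<alpha> (t s)) \<in> set_decode q)) \<longleftrightarrow>
        (\<exists>t\<in>T. \<forall>s\<in>S. Q (x \<otimes> (inv s\<^sub>0 \<otimes> s)) = t s)"
      if inD: "\<forall>s\<in>S. x \<otimes> (inv s\<^sub>0 \<otimes> s) \<in> D"
    proof -
      have "(\<forall>s\<in>S. prod_encode (r s (elt_code code x), \<alpha> (t s)) \<in> set_decode q) \<longleftrightarrow>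
          (\<forall>s\<in>S. Q (x \<otimes> (inv s\<^sub>0 \<otimes> s)) = t s)" if "t \<in> S \<rightarrow>\<^sub>E A" for t
        using x inD that by (intro ball_cong refl) (simp add: rD q PiE_mem[OF that])
      then show ?thesis
        using memT T by blast
    qed
    ultimately show "((\<forall>s\<in>S. r s (elt_code code x) \<in> elt_code code ` D) \<longrightarrow>
        (\<exists>t\<in>S \<rightarrow>\<^sub>E A. pattern_code code \<alpha> S t \<in> set_decode (family_code code \<alpha> S T) \<and>
           (\<forall>s\<in>S. prod_encode (r s (elt_code code x), \<alpha> (t s)) \<in> set_decode q))) \<longleftrightarrow>
      ((\<forall>s\<in>S. x \<otimes> (inv s\<^sub>0 \<otimes> s) \<in> D) \<longrightarrow>
        (\<exists>t\<in>T. \<forall>s\<in>S. Q (x \<otimes> (inv s\<^sub>0 \<otimes> s)) = t s))"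
      by blast
  qed
  ultimately show ?thesis
    unfolding codes_legal_extension_def dom graph by auto
qed

text \<open>
  Every pair in the graph of a pattern on \<open>D\<close> is at most the pair of the code of \<open>D\<close> and the largest
  symbol number, because an element of a finite set is smaller than the canonical index of the
  set. So the candidates are bounded by a computable function of the code of \<open>D\<close>.
\<close>

lemma ex_codes_legal_extension_iff:
  assumes code: "inj_on code (carrier G)" and \<alpha>: "inj_on \<alpha> A"
    and S: "S \<subseteq> carrier G" "finite S" and s0: "s\<^sub>0 \<in> S" and A: "finite A"
    and T: "T \<subseteq> S \<rightarrow>\<^sub>E A" and D: "D \<subseteq> carrier G" "finite D" and CD: "C \<subseteq> D"
    and r: "\<And>s x. s \<in> S \<Longrightarrow> x \<in> carrier G \<Longrightarrow>
      r s (elt_code code x) = elt_code code (x \<otimes> (inv s\<^sub>0 \<otimes> s))"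
    and P: "P \<in> C \<rightarrow>\<^sub>E A" and M: "\<And>a. a \<in> A \<Longrightarrow> \<alpha> a \<le> M"
  shows "(\<exists>q<2 ^ Suc (prod_encode (finset_code code D, M)).
      codes_legal_extension A \<alpha> S r (pattern_code code \<alpha> S) (family_code code \<alpha> S T)
        (pattern_code code \<alpha> C P) (finset_code code D) q) \<longleftrightarrow>
    (\<exists>Q \<in> D \<rightarrow>\<^sub>E A. legal_pattern G S T D Q \<and> restrict Q C = P)"
    (is "(\<exists>q<?b. ?test q) \<longleftrightarrow> ?R")
proof
  note test_iff = codes_legal_extension_iff[OF code \<alpha> S s0 A T D CD r P]
  have dom: "set_decode (finset_code code D) = elt_code code ` D"
    using D(2) by (simp add: finset_code_def)
  show ?R if ex: "\<exists>q<?b. ?test q"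
  proof -
    obtain q where q: "?test q"
      using ex by blast
    then have "\<forall>x\<in>D. \<exists>a\<in>A. prod_encode (elt_code code x, \<alpha> a) \<in> set_decode q \<and>
        (\<forall>b\<in>A - {a}. prod_encode (elt_code code x, \<alpha> b) \<notin> set_decode q)"
      unfolding codes_legal_extension_def dom by blast
    then obtain Q where Q: "\<And>x. x \<in> D \<Longrightarrow> Q x \<in> A \<and>
        prod_encode (elt_code code x, \<alpha> (Q x)) \<in> set_decode q \<and>
        (\<forall>b\<in>A - {Q x}. prod_encode (elt_code code x, \<alpha> b) \<notin> set_decode q)"
      by metis
    have "restrict Q D \<in> D \<rightarrow>\<^sub>E A"
      using Q by auto
    moreover have "prod_encode (elt_code code x, \<alpha> a) \<in> set_decode q \<longleftrightarrow> restrict Q D x = a"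
      if "x \<in> D" "a \<in> A" for x a
      using Q[OF that(1)] that by auto
    ultimately show ?R
      using test_iff q by blast
  qed
  show "\<exists>q<?b. ?test q" if ex: ?R
  proof -
    obtain Q where Q: "Q \<in> D \<rightarrow>\<^sub>E A" "legal_pattern G S T D Q" "restrict Q C = P"
      using ex by blast
    define q where "q = pattern_code code \<alpha> D Q"
    have "prod_encode (elt_code code x, \<alpha> a) \<in> set_decode q \<longleftrightarrow> Q x = a" if "x \<in> D" "a \<in> A" for x a
      using mem_pattern_code_iff[OF code D \<alpha> Q(1) _ that(2), of x] that D(1)
      by (auto simp: q_def)
    then have "?test q"
      using test_iff Q by blast
    moreover have "q < ?b"
    proof -
      have "prod_encode (elt_code code x, \<alpha> (Q x)) < Suc (prod_encode (finset_code code D, M))"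
        if "x \<in> D" for x
      proof -
        have "elt_code code x \<le> finset_code code D"
          using mem_set_decode_less[of "elt_code code x" "finset_code code D"] that dom by simp
        moreover have "\<alpha> (Q x) \<le> M"
          using M Q(1) that by blast
        ultimately show ?thesis
          by (simp add: less_Suc_eq_le prod_encode_mono)
      qed
      then show ?thesis
        unfolding q_def pattern_code_def by (intro set_encode_less_power) auto
    qed
    ultimately show ?thesis
      by blast
  qed
qed

text \<open>
  The enumeration of the convex sets is searched for one that contains the domain of the given
  pattern; the search stops because convex sets are cofinal. The remaining test is a bounded
  search.
\<close>

lemma SFT_language_decidable:
  assumes cnt: "countable (carrier G)" and S: "S \<subseteq> carrier G" "finite S" "S \<noteq> {}"
    and conv: "convexoid G \<C>" and ucp: "UCP G S \<C>"
    and A: "finite A" "A \<noteq> {}" and k: "k \<ge> 1"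
    and wp: "decidable_word_problem G m code" and \<alpha>: "inj_on \<alpha> A"
    and re: "recursively_enumerable_set (finset_code code ` \<C>)"
  shows "\<exists>f. partial_recursive f \<and>
    (\<forall>T. T \<subseteq> (S \<rightarrow>\<^sub>E A) \<and> TEP G \<C> S A k T \<longrightarrow>
      (\<forall>C. finite C \<and> C \<subseteq> carrier G \<longrightarrow>
        (\<forall>P \<in> C \<rightarrow>\<^sub>E A. f (prod_encode (family_code code \<alpha> S T, pattern_code code \<alpha> C P)) =
            Some (if occurs_in C P (SFT G S A T) then 1 else 0))))"
proof -
  have code: "inj_on code (carrier G)"
    using wp by (simp add: decidable_word_problem_def encoded_group_def)
  obtain s\<^sub>0 where s0: "s\<^sub>0 \<in> S"
    using S(3) by blast
  have "\<forall>s\<in>S. \<exists>r. recursive r \<and>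
      (\<forall>x\<in>carrier G. r (elt_code code x) = elt_code code (x \<otimes> (inv s\<^sub>0 \<otimes> s)))"
    using recursive_right_mult[OF wp] s0 S(1) by (simp add: subset_iff)
  then obtain r where r: "\<And>s. s \<in> S \<Longrightarrow> recursive (r s)"
    "\<And>s x. s \<in> S \<Longrightarrow> x \<in> carrier G \<Longrightarrow>
      r s (elt_code code x) = elt_code code (x \<otimes> (inv s\<^sub>0 \<otimes> s))"
    by metis
  have "finset_code code ` \<C> \<noteq> {}"
    using conv by (auto simp: convexoid_def)
  then obtain e where e: "recursive e" "finset_code code ` \<C> = range e"
    using re by (auto simp: recursively_enumerable_set_def recursive_def)
  define M where "M = Max (\<alpha> ` A)"
  have M: "\<alpha> a \<le> M" if "a \<in> A" for a
    using A(1) that by (simp add: M_def)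
  define covers where "covers = (\<lambda>n i. \<forall>z\<in>set_decode (proj2 n). proj1 z \<in> set_decode (e i))"
  define test where "test = (\<lambda>z. \<exists>q<2 ^ Suc (prod_encode (e (proj2 z), M)).
    codes_legal_extension A \<alpha> S r (pattern_code code \<alpha> S)
      (proj1 (proj1 z)) (proj2 (proj1 z)) (e (proj2 z)) q)"
  have "decidable (\<lambda>z. covers (proj1 z) (proj2 z))"
    unfolding covers_def
    by (intro decidable_Ball_set_decode decidable_mem_set_decode recursive_comp[OF e(1)]
        recursive_proj1 recursive_proj2 recursive_id)
  then have search: "partial_recursive (\<lambda>n. if \<exists>i. covers n i then Some (LEAST i. covers n i) else None)"
    by (rule partial_recursive_Least)
  have "decidable test"
    unfolding test_def
    by (intro decidable_bounded_Ex decidable_codes_legal_extension A(1) S(2) r(1)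
        recursive_power_2 recursive_Suc recursive_pair recursive_const recursive_comp[OF e(1)]
        recursive_proj1 recursive_proj2 recursive_id)
  then have answer: "partial_recursive (\<lambda>z. Some (if test z then 1 else 0))"
    by (simp add: decidable_iff recursive_def)
  define f where "f = (\<lambda>n. Option.bind (Option.bind (Some n) (\<lambda>x.
      Option.bind (if \<exists>i. covers n i then Some (LEAST i. covers n i) else None)
        (\<lambda>y. Some (prod_encode (x, y)))))
      (\<lambda>z. Some (if test z then 1 else 0 :: nat)))"
  have "partial_recursive f"
    unfolding f_def
    by (intro partial_recursive.comp partial_recursive.pair answer search
        recursive_id[unfolded recursive_def])
  moreover have "f (prod_encode (family_code code \<alpha> S T, pattern_code code \<alpha> C P)) =
      Some (if occurs_in C P (SFT G S A T) then 1 else 0)"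
    if T: "T \<subseteq> S \<rightarrow>\<^sub>E A" and tep: "TEP G \<C> S A k T" and C: "finite C" "C \<subseteq> carrier G"
      and P: "P \<in> C \<rightarrow>\<^sub>E A" for T C P
  proof -
    define n where "n = prod_encode (family_code code \<alpha> S T, pattern_code code \<alpha> C P)"
    have covers_iff: "covers n i \<longleftrightarrow> C \<subseteq> D" if "D \<in> \<C>" "e i = finset_code code D" for i D
    proof -
      have D: "D \<subseteq> carrier G" "finite D"
        using convexoid_subset[OF conv that(1)] convexoid_finite[OF conv that(1)] .
      have "covers n i \<longleftrightarrow> (\<forall>g\<in>C. elt_code code g \<in> elt_code code ` D)"
        using C(1) D(2) that(2)
        by (auto simp: covers_def n_def pattern_code_def finset_code_def)
      also have "\<dots> \<longleftrightarrow> C \<subseteq> D"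
        using inj_on_image_mem_iff[OF inj_on_elt_code[OF code] _ D(1)] C(2) by blast
      finally show ?thesis .
    qed
    obtain D\<^sub>1 where D1: "D\<^sub>1 \<in> \<C>" "C \<subseteq> D\<^sub>1"
      using convexoid_cofinal[OF conv C] by blast
    then obtain i\<^sub>1 where "e i\<^sub>1 = finset_code code D\<^sub>1"
      using e(2) by (metis rangeE imageI)
    then have ex: "\<exists>i. covers n i"
      using covers_iff[OF D1(1)] D1(2) by blast
    define i where "i = (LEAST i. covers n i)"
    have i: "covers n i"
      unfolding i_def using ex by (rule LeastI_ex)
    have "e i \<in> finset_code code ` \<C>"
      using e(2) by blast
    then obtain D where D: "D \<in> \<C>" "e i = finset_code code D"
      by blast
    then have CD: "C \<subseteq> D"
      using covers_iff i by blast
    have "f n = Some (if test (prod_encode (n, i)) then 1 else 0)"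
      using ex by (simp add: f_def i_def)
    moreover have "test (prod_encode (n, i)) \<longleftrightarrow>
        (\<exists>Q \<in> D \<rightarrow>\<^sub>E A. legal_pattern G S T D Q \<and> restrict Q C = P)"
      unfolding test_def
      using ex_codes_legal_extension_iff[OF code \<alpha> S(1,2) s0 A(1) T convexoid_subset[OF conv D(1)]
          convexoid_finite[OF conv D(1)] CD r(2) P M]
      by (simp add: n_def D(2))
    ultimately show ?thesis
      using occurs_in_SFT_iff[OF cnt S(1,2) conv ucp tep A(2) k D(1) CD] by (simp add: n_def)
  qed
  ultimately show ?thesis
    by blast
qed

end

theorem theorem19:
  fixes G :: "('g, 'm) monoid_scheme"
    and S :: "'g set" and \<C> :: "'g set set" and A :: "'a set" and k :: nat
  assumes "group G" and "countable (carrier G)"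
    and "S \<subseteq> carrier G" and "finite S" and "S \<noteq> {}"
    and "convexoid G \<C>" and "UCP G S \<C>"
    and "finite A" and "A \<noteq> {}" and "k \<ge> 1"
  shows
    "(\<forall>T. T \<subseteq> (S \<rightarrow>\<^sub>E A) \<and> TEP G \<C> S A k T \<longrightarrow>
        (\<forall>C\<in>\<C>. \<forall>P \<in> C \<rightarrow>\<^sub>E A. legal_pattern G S T C P \<longrightarrow>
           (\<exists>x\<in>SFT G S A T. restrict x C = P)))
     \<and>
     (\<forall>(m::nat) code (\<alpha> :: 'a \<Rightarrow> nat).
        decidable_word_problem G m code \<and> inj_on \<alpha> A \<and>
        recursively_enumerable_set (finset_code code ` \<C>) \<longrightarrow>
        (\<exists>f. partial_recursive f \<and>
           (\<forall>T. T \<subseteq> (S \<rightarrow>\<^sub>E A) \<and> TEP G \<C> S A k T \<longrightarrow>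
              (\<forall>C. finite C \<and> C \<subseteq> carrier G \<longrightarrow>
                 (\<forall>P \<in> C \<rightarrow>\<^sub>E A.
                    f (prod_encode (family_code code \<alpha> S T, pattern_code code \<alpha> C P)) =
                      Some (if occurs_in C P (SFT G S A T) then 1 else 0))))))"
proof -
  interpret group G
    by fact
  show ?thesis
    using legal_pattern_extend_SFT[OF assms(2-4,6,7) _ assms(9,10)]
      SFT_language_decidable[OF assms(2-10)] by blast
qed

end
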